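(* For all $f\in H^\infty_0(\mathbb{D})$ and every $N\in\mathbb{N}$, $$\sup_{z\in\mathbb{T}}\left|(S_N(f))\left(\tfrac12 z\right)\right|\leq \|f\|_\infty,$$ and the constant $\frac12$ is the best possible; that is, for every real $r>\frac12$ there exist $f\in H^\infty_0(\mathbb{D})$ and $N\in\mathbb{N}$ such that $\sup_{z\in\mathbb{T}}|(S_N(f))(rz)|>\|f\|_\infty$.
   Context: $\mathbb{D}$ is the open unit disc in $\mathbb{C}$ and $\mathbb{T}=\partial\mathbb{D}$ is the unit circle; $\mathbb{N}=\{1,2,3,\dots\}$. $H^\infty(\mathbb{D})$ is the Banach algebra of bounded (scalar-valued) analytic functions on $\mathbb{D}$ with norm $\|f\|_\infty=\sup_{z\in\mathbb{D}}|f(z)|$. The subset $H^\infty_0(\mathbb{D})\subset H^\infty(\mathbb{D})$ is defined by $H^\infty_0(\mathbb{D})=\{f\in H^\infty(\mathbb{D}): f(z)\neq 0\text{ for all }z\in\mathbb{D}\}$. For an analytic function $f(z)=\sum_{n=0}^\infty a_nz^n$ on $\mathbb{D}$ and $N\in\mathbb{N}$, the $N$-th partial sum is the polynomial $(S_N(f))(z)=\sum_{n=0}^N a_nz^n$. *)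

theory Defs
  imports "HOL-Complex_Analysis.Complex_Analysis"
begin

(* Functions on the unit disc are total functions on the complex plane; their values outside
   the open unit ball are irrelevant to every notion below. *)

definition H_infinity :: "(complex \<Rightarrow> complex) set" where
  "H_infinity = {f. f holomorphic_on ball 0 1 \<and> bounded (f ` ball 0 1)}"

definition H_infinity_nz :: "(complex \<Rightarrow> complex) set" where
  "H_infinity_nz = {f \<in> H_infinity. \<forall>z\<in>ball 0 1. f z \<noteq> 0}"

definition H_infinity_norm :: "(complex \<Rightarrow> complex) \<Rightarrow> real" where
  "H_infinity_norm f = (SUP z\<in>ball 0 1. norm (f z))"

(* The sum includes the terms of index 0 and N, so it has N + 1 summands. *)
definition taylor_partial_sum :: "nat \<Rightarrow> (complex \<Rightarrow> complex) \<Rightarrow> complex \<Rightarrow> complex" where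
  "taylor_partial_sum N f z = (\<Sum>n\<le>N. fps_nth (fps_expansion f 0) n * z ^ n)"

end

theory Submission
  imports Defs
begin

text \<open>
  Convolving \<open>f\<close> on a circle of radius \<open>R < 1\<close> with the kernel
  \<open>1 + 2 Re (\<Sum>n=1..N. q ^ n)\<close>, where \<open>q = w / u\<close> has modulus \<open>1/2\<close>, yields the partial sum of \<open>f\<close> at
  \<open>w\<close>. The kernel is nonnegative and has mean \<open>1\<close>, so the partial sum is bounded by the norm of \<open>f\<close>;
  then \<open>R \<rightarrow> 1\<close>. For the sharpness take \<open>N = 1\<close> and \<open>f z = exp (- t (1 - z) / (1 + z))\<close> with small
  \<open>t > 0\<close>, whose first partial sum is \<open>exp (- t) (1 + 2 t z)\<close>.
\<close>

text \<open>The geometric series gives \<open>(1 - q) * (1 + 2 * S) = 1 + q - 2 * q ^ Suc N\<close>.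
  Multiplying by \<open>cnj (1 - q)\<close> turns the left side into \<open>1 + 2 * S\<close> times
  a positive real, and the right side has real part at least 3/4 minus an error that |q| = 1/2 keeps
  below 3/4.\<close>

lemma half_geometric_kernel_nonneg:
  fixes q :: complex
  assumes "norm q = 1 / 2"
  shows "0 \<le> 1 + 2 * Re (\<Sum>n=1..N. q ^ n)"
proof (cases "N = 0")
  case False
  define S where "S = (\<Sum>n=1..N. q ^ n)"
  have q1: "q \<noteq> 1" using assms by auto
  have "(1 - q) * S = q - q ^ Suc N"
    using False unfolding S_def by (subst sum_gp_multiplied) auto
  moreover have "(1 - q) * (1 + 2 * S) = 1 - q + 2 * ((1 - q) * S)"
    by (simp add: algebra_simps)
  ultimately have eq: "(1 - q) * (1 + 2 * S) = 1 + q - 2 * q ^ Suc N"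
    by simp
  have sq: "q * cnj q = 1 / 4"
    using complex_norm_square[of q] assms by (simp add: power2_eq_square)
  have "(1 + 2 * S) * of_real ((norm (1 - q))\<^sup>2) = (1 + q - 2 * q ^ Suc N) * cnj (1 - q)"
    unfolding complex_norm_square eq[symmetric] by (simp add: algebra_simps)
  \<comment> \<open>The term \<open>q - cnj q\<close> is purely imaginary and disappears when real
    parts are taken.\<close>
  also have "\<dots> = 1 - q * cnj q + (q - cnj q) - 2 * (q ^ Suc N * cnj (1 - q))"
    by (simp add: algebra_simps)
  also have "\<dots> = 3 / 4 + (q - cnj q) - 2 * (q ^ Suc N * cnj (1 - q))"
    unfolding sq by simp
  finally have "Re ((1 + 2 * S) * of_real ((norm (1 - q))\<^sup>2))
      = Re (3 / 4 + (q - cnj q) - 2 * (q ^ Suc N * cnj (1 - q)))"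
    by (rule arg_cong)
  moreover have "Re (x * of_real c) = Re x * c" "Re (2 * x) = 2 * Re x" for x c
    by auto
  ultimately have re: "(1 + 2 * Re S) * (norm (1 - q))\<^sup>2 = 3 / 4 - 2 * Re (q ^ Suc N * cnj (1 - q))"
    by (simp del: times_complex.sel of_real_power power_Suc)
  \<comment> \<open>The bound 3/8 is exactly what \<open>3 / 4 - 2 * _\<close> tolerates; it is
    attained at N = 1, q = -1/2. The factor \<open>(1 / 2) ^ 2\<close> needs N at least 1, hence the
    separate case N = 0.\<close>
  have "Re (q ^ Suc N * cnj (1 - q)) \<le> norm (q ^ Suc N * cnj (1 - q))"
    by (rule complex_Re_le_cmod)
  also have "\<dots> = (1 / 2) ^ Suc N * norm (1 - q)"
    by (simp only: norm_mult norm_power assms complex_mod_cnj)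
  also have "\<dots> \<le> (1 / 2) ^ 2 * (3 / 2)"
  proof (rule mult_mono)
    show "(1 / 2) ^ Suc N \<le> ((1 / 2) ^ 2 :: real)"
      using False by (intro power_decreasing) auto
    show "norm (1 - q) \<le> 3 / 2"
      using norm_triangle_ineq4[of 1 q] assms by simp
  qed auto
  finally have "0 \<le> (1 + 2 * Re S) * (norm (1 - q))\<^sup>2"
    unfolding re by (simp add: power2_eq_square)
  then show ?thesis
    using q1 unfolding S_def by (simp add: zero_le_mult_iff)
qed simp

lemma vector_derivative_circlepath_0:
  "vector_derivative (circlepath 0 R) (at x) = 2 * pi * \<i> * circlepath 0 R x"
  unfolding vector_derivative_circlepath by (simp add: circlepath)

lemma norm_circlepath_0: "0 < R \<Longrightarrow> norm (circlepath 0 R x) = R"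
  by (simp add: circlepath norm_mult)

text \<open>Cauchy's formula for the n-th derivative at 0: on the circle du = 2 pi i u dt, which
  cancels one power of u in the denominator and the factor 2 pi i.\<close>

lemma has_integral_circlepath_fps_expansion:
  assumes holo: "g holomorphic_on ball 0 1" and R: "0 < R" "R < 1"
  shows "((\<lambda>t. g (circlepath 0 R t) / circlepath 0 R t ^ n)
           has_integral fps_nth (fps_expansion g 0) n) {0..1}"
proof -
  have nz: "circlepath 0 R x \<noteq> 0" for x
    using norm_circlepath_0[of R x] R by auto
  have "((\<lambda>u. g u / (u - 0) ^ Suc n) has_contour_integral
           (2 * pi * \<i>) / fact n * (deriv ^^ n) g 0) (circlepath 0 R)"
    by (rule Cauchy_has_contour_integral_higher_derivative_circlepath)
      (use R in \<open>auto intro!: holomorphic_on_imp_continuous_on holomorphic_on_subset[OF holo]\<close>)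
  then have "((\<lambda>t. 2 * pi * \<i> * (g (circlepath 0 R t) / circlepath 0 R t ^ n))
      has_integral 2 * pi * \<i> * fps_nth (fps_expansion g 0) n) {0..1}"
    unfolding has_contour_integral
    by (rule has_integral_eq_rhs[OF has_integral_eq, rotated])
      (use R nz in \<open>auto simp: vector_derivative_circlepath_0 fps_expansion_def\<close>)
  from has_integral_mult_right[OF this, of "1 / (2 * pi * \<i>)"] show ?thesis
    by simp
qed

text \<open>Since u^n dt = u^(n-1) du / (2 pi i) and n is at least 1, the integrand comes from a
  function holomorphic on the disc, so Cauchy's theorem applies.\<close>

lemma has_integral_circlepath_power_mult:
  assumes holo: "g holomorphic_on ball 0 1" and R: "0 < R" "R < 1" and n: "n \<ge> 1"
  shows "((\<lambda>t. g (circlepath 0 R t) * circlepath 0 R t ^ n) has_integral 0) {0..1}"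
proof -
  obtain m where m: "n = Suc m" using n by (cases n) auto
  have "((\<lambda>u. g u * u ^ m) has_contour_integral 0) (circlepath 0 R)"
    by (rule Cauchy_theorem_disc_simple[of _ 0 1]) (use R holo in \<open>auto intro!: holomorphic_intros\<close>)
  then have "((\<lambda>t. 2 * pi * \<i> * (g (circlepath 0 R t) * circlepath 0 R t ^ n))
      has_integral 0) {0..1}"
    unfolding has_contour_integral
    by (rule has_integral_eq[rotated])
      (auto simp: vector_derivative_circlepath_0 m)
  from has_integral_mult_right[OF this, of "1 / (2 * pi * \<i>)"] show ?thesis
    by simp
qed

text \<open>Twice the real part is the sum plus its conjugate. On the circle \<open>cnj u\<close> is
  R^2 / u, so the conjugate part consists of positive powers of u and integrates to 0 against g,
  while the powers of w / u produce the Taylor terms.\<close>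

lemma has_integral_kernel_taylor_partial_sum:
  assumes holo: "g holomorphic_on ball 0 1" and R: "0 < R" "R < 1"
  shows "((\<lambda>t. of_real (1 + 2 * Re (\<Sum>n=1..N. (w / circlepath 0 R t) ^ n)) * g (circlepath 0 R t))
           has_integral taylor_partial_sum N g w) {0..1}"
proof -
  let ?u = "circlepath 0 R" and ?a = "fps_nth (fps_expansion g 0)"
  have conj: "cnj (?u t) = of_real (R\<^sup>2) / ?u t" for t
    using complex_norm_square[of "?u t"] norm_circlepath_0[of R t] R by (auto simp: field_simps)
  have "((\<lambda>t. g (?u t) / ?u t ^ 0 +
        (\<Sum>n=1..N. w ^ n * (g (?u t) / ?u t ^ n) + (cnj w / of_real (R\<^sup>2)) ^ n * (g (?u t) * ?u t ^ n)))
      has_integral ?a 0 + (\<Sum>n=1..N. w ^ n * ?a n + (cnj w / of_real (R\<^sup>2)) ^ n * 0)) {0..1}"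
    by (intro has_integral_add has_integral_sum has_integral_mult_right
        has_integral_circlepath_fps_expansion[OF holo R]
        has_integral_circlepath_power_mult[OF holo R]) auto
  moreover have "?a 0 + (\<Sum>n=1..N. w ^ n * ?a n + (cnj w / of_real (R\<^sup>2)) ^ n * 0)
      = taylor_partial_sum N g w"
    unfolding taylor_partial_sum_def atMost_atLeast0
    by (subst sum.atLeast_Suc_atMost) (auto simp: mult.commute)
  moreover have "g (?u t) / ?u t ^ 0 +
        (\<Sum>n=1..N. w ^ n * (g (?u t) / ?u t ^ n) + (cnj w / of_real (R\<^sup>2)) ^ n * (g (?u t) * ?u t ^ n))
      = of_real (1 + 2 * Re (\<Sum>n=1..N. (w / ?u t) ^ n)) * g (?u t)" for t
  proof -
    have "of_real (2 * Re (\<Sum>n=1..N. (w / ?u t) ^ n))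
        = (\<Sum>n=1..N. (w / ?u t) ^ n) + cnj (\<Sum>n=1..N. (w / ?u t) ^ n)"
      by (rule complex_add_cnj[symmetric])
    also have "\<dots> = (\<Sum>n=1..N. (w / ?u t) ^ n + (cnj w / of_real (R\<^sup>2) * ?u t) ^ n)"
      unfolding cnj_sum complex_cnj_power complex_cnj_divide conj sum.distrib[symmetric] by simp
    finally show ?thesis
      by (simp add: distrib_left sum_distrib_left power_divide power_mult_distrib mult_ac)
  qed
  ultimately show ?thesis by simp
qed

lemma norm_taylor_partial_sum_le:
  assumes holo: "f holomorphic_on ball 0 1" and bd: "\<And>z. z \<in> ball 0 1 \<Longrightarrow> norm (f z) \<le> M"
    and R: "0 < R" "R < 1" and w: "norm w = R / 2"
  shows "norm (taylor_partial_sum N f w) \<le> M"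
proof -
  let ?u = "circlepath 0 R"
  define k where "k t = 1 + 2 * Re (\<Sum>n=1..N. (w / ?u t) ^ n)" for t
  have nu: "norm (?u t) = R" for t using R by (simp add: norm_circlepath_0)
  have k0: "0 \<le> k t" for t
    unfolding k_def using R by (intro half_geometric_kernel_nonneg) (simp add: norm_divide nu w)
  have f: "((\<lambda>t. of_real (k t) * f (?u t)) has_integral taylor_partial_sum N f w) {0..1}"
    unfolding k_def by (rule has_integral_kernel_taylor_partial_sum[OF holo R])
  \<comment> \<open>The mean of the kernel comes from the same representation, applied to the
    constant 1, whose partial sums all equal 1.\<close>
  have "((\<lambda>t. of_real (k t) * 1) has_integral taylor_partial_sum N (\<lambda>_. 1) w) {0..1}"
    unfolding k_def by (rule has_integral_kernel_taylor_partial_sum[OF _ R]) auto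
  also have "taylor_partial_sum N (\<lambda>_. 1) w = 1"
    unfolding taylor_partial_sum_def fps_expansion_def by (subst sum.atMost_shift) simp
  finally have "(k has_integral 1) {0..1}"
    by (auto dest: has_integral_Re)
  from has_integral_mult_right[OF this, of M]
  have M: "((\<lambda>t. M * k t) has_integral M) {0..1}" by simp
  have "norm (integral {0..1} (\<lambda>t. of_real (k t) * f (?u t))) \<le> integral {0..1} (\<lambda>t. M * k t)"
  proof (rule integral_norm_bound_integral)
    show "norm (of_real (k t) * f (?u t)) \<le> M * k t" for t
      using mult_right_mono[OF bd[of "?u t"] k0[of t]] k0[of t] nu[of t] R
      by (simp add: norm_mult mult.commute)
  qed (use f M in \<open>auto simp: integrable_on_def\<close>)
  then show ?thesis
    unfolding integral_unique[OF f] integral_unique[OF M] .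
qed

lemma continuous_on_taylor_partial_sum [continuous_intros]:
  "continuous_on A g \<Longrightarrow> continuous_on A (\<lambda>z. taylor_partial_sum N f (g z))"
  unfolding taylor_partial_sum_def by (intro continuous_intros)

text \<open>The partial sum is a polynomial, hence continuous, so the bound on |w| = R/2 survives
  the limit R to 1 from the left, although f itself is controlled only inside the disc.\<close>

lemma norm_taylor_partial_sum_half_le:
  assumes "f holomorphic_on ball 0 1" and "\<And>z. z \<in> ball 0 1 \<Longrightarrow> norm (f z) \<le> M"
    and z: "norm z = 1"
  shows "norm (taylor_partial_sum N f (1 / 2 * z)) \<le> M"
proof -
  let ?p = "\<lambda>R. norm (taylor_partial_sum N f (of_real R * z / 2))"
  have "continuous_on UNIV ?p" by (intro continuous_intros) auto
  then have "isCont ?p 1" by (simp add: continuous_on_eq_continuous_at)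
  then have "(?p \<longlongrightarrow> ?p 1) (at_left 1)"
    unfolding isCont_def by (rule tendsto_mono[OF at_le, rotated]) simp
  moreover have "eventually (\<lambda>R. ?p R \<le> M) (at_left 1)"
    unfolding eventually_at_left_field using z
    by (intro exI[of _ 0] conjI allI impI norm_taylor_partial_sum_le[OF assms(1,2)])
      (auto simp: norm_mult)
  ultimately have "?p 1 \<le> M"
    by (intro tendsto_upperbound) auto
  then show ?thesis by simp
qed

lemma norm_le_H_infinity_norm:
  assumes "f \<in> H_infinity" "z \<in> ball 0 1"
  shows "norm (f z) \<le> H_infinity_norm f"
  unfolding H_infinity_norm_def
proof (rule cSUP_upper[OF assms(2)])
  show "bdd_above ((\<lambda>z. norm (f z)) ` ball 0 1)"
    using assms(1) by (auto simp: H_infinity_def bounded_iff bdd_above_def)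
qed

lemma half_radius_sharp:
  fixes r :: real
  assumes r: "r > 1 / 2"
  shows "\<exists>f\<in>H_infinity_nz. H_infinity_norm f
    < (SUP z\<in>sphere (0::complex) 1. norm (taylor_partial_sum 1 f (complex_of_real r * z)))"
proof -
  \<comment> \<open>The quadratic \<open>(1 - t) * (1 + 2 * t * r)\<close> equals 1 at t = 0 and at
    t = (2r - 1)/(2r); the midpoint, where it is largest, is chosen.\<close>
  define t where "t = (2 * r - 1) / (4 * r)"
  have t: "0 < t" using r by (simp add: t_def)
  define f where "f z = exp (- (of_real t * ((1 - z) / (1 + z))))" for z :: complex
  have ne: "1 + z \<noteq> 0" if "norm z < 1" for z :: complex
    using that by (metis add_eq_0_iff norm_minus_cancel norm_one order_less_irrefl)
  have bd: "norm (f z) \<le> 1" if "z \<in> ball 0 1" for z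
  proof -
    \<comment> \<open>The map (1 - z)/(1 + z) sends the disc into the right half-plane: its real
      part is (1 - |z|^2) / |1 + z|^2.\<close>
    have "(norm z)\<^sup>2 \<le> 1" using that by (simp add: abs_square_le_1)
    then have "0 \<le> Re (1 - z) * Re (1 + z) + Im (1 - z) * Im (1 + z)"
      unfolding cmod_power2 by (simp add: algebra_simps power2_eq_square)
    then have "0 \<le> Re ((1 - z) / (1 + z))"
      unfolding Re_divide by (intro divide_nonneg_nonneg) auto
    then have "0 \<le> Re (of_real t * ((1 - z) / (1 + z)))"
      using t by (simp del: Re_divide times_divide_eq_right)
    then show ?thesis unfolding f_def norm_exp_eq_Re by simp
  qed
  have "f holomorphic_on ball 0 1"
    unfolding f_def by (intro holomorphic_intros) (auto simp: ne)
  moreover have "bounded (f ` ball 0 1)" using bd unfolding bounded_iff by blast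
  moreover have "f z \<noteq> 0" for z by (simp add: f_def)
  ultimately have f: "f \<in> H_infinity_nz"
    by (simp add: H_infinity_nz_def H_infinity_def)
  have "(f has_field_derivative 2 * of_real t * exp (- of_real t)) (at 0)"
    unfolding f_def by (auto intro!: derivative_eq_intros)
  then have d: "deriv f 0 = 2 * of_real t * exp (- of_real t)"
    by (rule DERIV_imp_deriv)
  have "taylor_partial_sum 1 f (of_real r * 1) = of_real (exp (- t) * (1 + 2 * t * r))"
    unfolding taylor_partial_sum_def fps_expansion_def
    by (simp add: d) (simp add: f_def exp_of_real[symmetric] algebra_simps)
  then have val: "norm (taylor_partial_sum 1 f (of_real r * 1)) = exp (- t) * (1 + 2 * t * r)"
    using t r by (simp only: norm_of_real) simp
  have "H_infinity_norm f \<le> 1"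
    unfolding H_infinity_norm_def by (rule cSUP_least) (use bd in auto)
  also have "1 < (1 - t) * (1 + 2 * t * r)"
  proof -
    have "(1 - t) * (1 + 2 * t * r) = 1 + t * ((2 * r - 1) - 2 * r * t)"
      by (simp add: algebra_simps)
    also have "2 * r * t = (2 * r - 1) / 2" using r by (simp add: t_def)
    finally show ?thesis using t r by simp
  qed
  \<comment> \<open>The estimate exp(-t) >= 1 - t reduces the strict inequality to the polynomial
    one above.\<close>
  also have "\<dots> \<le> exp (- t) * (1 + 2 * t * r)"
    using exp_ge_add_one_self[of "- t"] t r by (intro mult_right_mono) auto
  \<comment> \<open>The value at z = 1 bounds the supremum from below; compactness of the circle
    makes that supremum finite.\<close>
  also have "\<dots> \<le> (SUP z\<in>sphere (0::complex) 1. norm (taylor_partial_sum 1 f (of_real r * z)))"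
    unfolding val[symmetric]
  proof (rule cSUP_upper)
    show "bdd_above ((\<lambda>z. norm (taylor_partial_sum 1 f (of_real r * z))) ` sphere 0 1)"
      by (intro bounded_imp_bdd_above compact_imp_bounded compact_continuous_image
          continuous_intros) auto
  qed auto
  finally show ?thesis using f by blast
qed

theorem proposition3p1:
  shows "(\<forall>f\<in>H_infinity_nz. \<forall>N\<ge>1.
            (SUP z\<in>sphere (0::complex) 1. norm (taylor_partial_sum N f ((1 / 2) * z)))
              \<le> H_infinity_norm f) \<and>
         (\<forall>r>1 / 2 :: real. \<exists>f\<in>H_infinity_nz. \<exists>N\<ge>1.
            (SUP z\<in>sphere (0::complex) 1. norm (taylor_partial_sum N f (complex_of_real r * z)))
              > H_infinity_norm f)"
proof (intro conjI ballI allI impI)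
  fix f N
  assume "f \<in> H_infinity_nz"
  then have f: "f \<in> H_infinity" by (simp add: H_infinity_nz_def)
  show "(SUP z\<in>sphere (0::complex) 1. norm (taylor_partial_sum N f ((1 / 2) * z)))
      \<le> H_infinity_norm f"
  proof (rule cSUP_least)
    fix z :: complex
    assume "z \<in> sphere 0 1"
    then show "norm (taylor_partial_sum N f ((1 / 2) * z)) \<le> H_infinity_norm f"
      using f by (intro norm_taylor_partial_sum_half_le norm_le_H_infinity_norm)
        (auto simp: H_infinity_def)
  qed auto
next
  fix r :: real
  assume "1 / 2 < r"
  from half_radius_sharp[OF this]
  show "\<exists>f\<in>H_infinity_nz. \<exists>N\<ge>1.
      (SUP z\<in>sphere (0::complex) 1. norm (taylor_partial_sum N f (complex_of_real r * z)))
        > H_infinity_norm f"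
    by blast
qed

end
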